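(* Assume $\operatorname{rank} W_0=n+m$. Consider the direct data-driven LQR problem (D) and its regularized version (R$_\lambda$) with parameter $\lambda\ge 0$, both defined in the context. The two problems (D) and (R$_\lambda$) coincide for $\lambda$ sufficiently large. Otherwise, for general $\lambda\ge 0$, problem (R$_\lambda$) lower-bounds problem (D), i.e. the optimal value of (R$_\lambda$) is at most the optimal value of (D).
   Context: Data: $u(k)\in\mathbb R^m$, $x(k)\in\mathbb R^n$ are generated by $x(k+1)=Ax(k)+Bu(k)+d(k)$ with unknown real matrices $A\in\mathbb R^{n\times n}$, $B\in\mathbb R^{n\times m}$, $(A,B)$ stabilizable, and an unknown disturbance $d(k)\in\mathbb R^n$ not required to follow any particular statistics. Set $U_0=[u(0)\ \cdots\ u(T-1)]\in\mathbb R^{m\times T}$, $X_0=[x(0)\ \cdots\ x(T-1)]\in\mathbb R^{n\times T}$, $X_1=[x(1)\ \cdots\ x(T)]\in\mathbb R^{n\times T}$, and $W_0=\begin{bmatrix}U_0\\ X_0\end{bmatrix}\in\mathbb R^{(n+m)\times T}$. When $\operatorname{rank}W_0=n+m$, $W_0^\dagger=W_0^\top(W_0W_0^\top)^{-1}$ denotes the (Moore–Penrose) right inverse of $W_0$, and $\Pi:=I-W_0^\dagger W_0$ is the orthogonal projector onto the nullspace of $W_0$. $Q\in\mathbb R^{n\times n}$ and $R\in\mathbb R^{m\times m}$ are symmetric positive definite weighting matrices. $P\in\mathbb R^{n\times n}$ is symmetric, $K\in\mathbb R^{m\times n}$, $G\in\mathbb R^{T\times n}$; $\succeq,\preceq$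 denote the semidefinite order; $\|\cdot\|$ is any matrix norm. Problem (D): minimize $\operatorname{trace}(QP+K^\top RKP)$ over $P\succeq I$, $K$ and $G$, subject to $X_1GPG^\top X_1^\top-P+I\preceq0$, $\begin{bmatrix}K\\ I\end{bmatrix}=W_0G$, and $\Pi G=0$. Problem (R$_\lambda$): minimize $\operatorname{trace}(QP+K^\top RKP)+\lambda\,\|\Pi G\|$ over $P\succeq I$, $K$ and $G$, subject to $X_1GPG^\top X_1^\top-P+I\preceq0$ and $\begin{bmatrix}K\\ I\end{bmatrix}=W_0G$. The optimal value of a minimization problem is the infimum of its objective over its feasible set ($+\infty$ if the feasible set is empty).
   Formalization: The claim that the two problems coincide for large λ is stated under the added condition that (D) is feasible whenever (R_λ) is; otherwise (R_λ) has a finite optimal value for every λ while that of (D) is +∞, so the claim fails. *)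

theory Defs
  imports "HOL-Analysis.Analysis"
begin

section \<open>Matrices\<close>

text \<open>Semidefinite order on symmetric real matrices; symmetry is part of both notions, since
  the quadratic form only sees the symmetric part of a matrix.\<close>

definition psd :: "real^'n^'n \<Rightarrow> bool" where
  "psd M \<longleftrightarrow> transpose M = M \<and> (\<forall>v. 0 \<le> v \<bullet> (M *v v))"

definition pos_def :: "real^'n^'n \<Rightarrow> bool" where
  "pos_def M \<longleftrightarrow> transpose M = M \<and> (\<forall>v. v \<noteq> 0 \<longrightarrow> 0 < v \<bullet> (M *v v))"

definition loewner_le :: "real^'n^'n \<Rightarrow> real^'n^'n \<Rightarrow> bool"  (infix \<open>\<preceq>\<^sub>L\<close> 50) where
  "M \<preceq>\<^sub>L N \<longleftrightarrow> psd (N - M)"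

definition is_norm :: "('v::real_vector \<Rightarrow> real) \<Rightarrow> bool" where
  "is_norm \<nu> \<longleftrightarrow>
     (\<forall>v. \<nu> v = 0 \<longleftrightarrow> v = 0) \<and>
     (\<forall>c v. \<nu> (c *\<^sub>R v) = \<bar>c\<bar> * \<nu> v) \<and>
     (\<forall>v w. \<nu> (v + w) \<le> \<nu> v + \<nu> w)"

definition schur_stable :: "real^'n^'n \<Rightarrow> bool" where
  "schur_stable M \<longleftrightarrow>
     (\<forall>(z::complex) v. v \<noteq> 0 \<longrightarrow> map_matrix complex_of_real M *v v = z *s v \<longrightarrow> cmod z < 1)"

definition stabilizable :: "real^'n^'n \<Rightarrow> real^'m^'n \<Rightarrow> bool" where
  "stabilizable A B \<longleftrightarrow> (\<exists>F :: real^'n^'m. schur_stable (A + B ** F))"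

definition vstack :: "'a^'c^'m \<Rightarrow> 'a^'c^'n \<Rightarrow> 'a^'c^('m + 'n)" where
  "vstack M N = (\<chi> i. case i of Inl a \<Rightarrow> M $ a | Inr b \<Rightarrow> N $ b)"

section \<open>Data matrices\<close>

text \<open>The number of samples is \<open>CARD('t)\<close>, and \<open>\<tau>\<close> numbers the columns by
  \<open>0, \<dots>, CARD('t) - 1\<close>.\<close>

definition data_matrix :: "('t \<Rightarrow> nat) \<Rightarrow> (nat \<Rightarrow> real^'n) \<Rightarrow> real^'t^'n" where
  "data_matrix \<tau> s = (\<chi> i j. s (\<tau> j) $ i)"

definition right_inv :: "real^'t^'r \<Rightarrow> real^'r^'t" where
  "right_inv W = transpose W ** matrix_inv (W ** transpose W)"

definition null_proj :: "real^'t^'r \<Rightarrow> real^'t^'t" where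
  "null_proj W = mat 1 - right_inv W ** W"

section \<open>The two optimization problems\<close>

definition opt_val :: "('v \<Rightarrow> real) \<Rightarrow> 'v set \<Rightarrow> ereal" where
  "opt_val f S = (INF z\<in>S. ereal (f z))"

definition minimizers :: "('v \<Rightarrow> real) \<Rightarrow> 'v set \<Rightarrow> 'v set" where
  "minimizers f S = {z \<in> S. \<forall>w\<in>S. f z \<le> f w}"

definition lqr_cost ::
  "real^'n^'n \<Rightarrow> real^'m^'m \<Rightarrow> (real^'n^'n) \<times> (real^'n^'m) \<times> (real^'n^'t) \<Rightarrow> real" where
  "lqr_cost Q R = (\<lambda>(P, K, G). trace (Q ** P + transpose K ** R ** K ** P))"

definition reg_cost ::
  "real^'n^'n \<Rightarrow> real^'m^'m \<Rightarrow> real^'t^('m + 'n) \<Rightarrow> (real^'n^'t \<Rightarrow> real) \<Rightarrow> real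
     \<Rightarrow> (real^'n^'n) \<times> (real^'n^'m) \<times> (real^'n^'t) \<Rightarrow> real" where
  "reg_cost Q R W0 \<nu> lam = (\<lambda>(P, K, G). lqr_cost Q R (P, K, G) + lam * \<nu> (null_proj W0 ** G))"

definition reg_feasible ::
  "real^'t^'n \<Rightarrow> real^'t^('m + 'n) \<Rightarrow> ((real^'n^'n) \<times> (real^'n^'m) \<times> (real^'n^'t)) set" where
  "reg_feasible X1 W0 = {(P, K, G).
     transpose P = P \<and> mat 1 \<preceq>\<^sub>L P \<and>
     (X1 ** G ** P ** transpose G ** transpose X1 - P + mat 1) \<preceq>\<^sub>L 0 \<and>
     vstack K (mat 1) = W0 ** G}"

text \<open>The estimated system \<open>X1 ** right_inv W0\<close> need not be stabilizable, even if the true one is.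
  The set below can therefore be empty while \<open>reg_feasible X1 W0\<close> is not; the optimal value of
  the direct problem is then \<open>\<infinity>\<close>, that of the regularized one is finite for every weight, and the
  two cannot coincide.\<close>

definition direct_feasible ::
  "real^'t^'n \<Rightarrow> real^'t^('m + 'n) \<Rightarrow> ((real^'n^'n) \<times> (real^'n^'m) \<times> (real^'n^'t)) set" where
  "direct_feasible X1 W0 = {(P, K, G).
     (P, K, G) \<in> reg_feasible X1 W0 \<and> null_proj W0 ** G = 0}"

end

theory Submission
  imports Defs
begin

text \<open>Let \<open>J\<close> be the optimal value of the direct problem and \<open>N\<close> the component of \<open>G\<close> in the
  nullspace of \<open>W0\<close>. A point \<open>(P, K, G)\<close> of the regularized problem with cost at most \<open>J\<close> has
  trace of \<open>P\<close> bounded by a multiple of \<open>J\<close>, since \<open>Q\<close> is positive definite. Removing \<open>N\<close> from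
  \<open>G\<close> then perturbs the Lyapunov inequality by at most \<open>\<delta>\<close> times the identity, where \<open>\<delta>\<close> is
  at most linear in the norm of \<open>N\<close> near zero. As the identity also appears as the noise covariance,
  dividing \<open>P\<close> by \<open>1 - \<delta>\<close> gives a feasible point of the direct problem, so \<open>(1 - \<delta>) J\<close> is a
  lower bound of the cost. Hence \<open>J\<close> is at most the cost plus \<open>L\<close> times the norm of \<open>N\<close>, and every
  weight above \<open>L\<close> makes the penalty exact.\<close>

section \<open>Matrix arithmetic\<close>

lemma matrix_mul_diff_right:
  fixes X :: "'a::ring_1^'n^'m"
  shows "X ** (Y - Z) = X ** Y - X ** Z"
  by (simp add: matrix_matrix_mult_def vec_eq_iff right_diff_distrib sum_subtractf)

lemma matrix_mul_diff_left:
  fixes X :: "'a::ring_1^'n^'m"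
  shows "(X - Y) ** Z = X ** Z - Y ** Z"
  by (simp add: matrix_matrix_mult_def vec_eq_iff left_diff_distrib sum_subtractf)

lemma matrix_mul_scaleR_right:
  fixes X :: "real^'n^'m"
  shows "X ** (c *\<^sub>R Y) = c *\<^sub>R (X ** Y)"
  by (simp add: matrix_matrix_mult_def vec_eq_iff sum_distrib_left mult_ac)

lemma transpose_diff: "transpose (X - Y) = transpose X - (transpose Y :: 'a::ab_group_add^'n^'m)"
  by (simp add: transpose_def vec_eq_iff)

lemma trace_scaleR: "trace (c *\<^sub>R X) = c * trace (X :: real^'n^'n)"
  by (simp add: trace_def sum_distrib_left)

section \<open>Positive semidefinite matrices\<close>

lemma symmetric_form_commute:
  fixes P :: "real^'n^'n"
  assumes "transpose P = P"
  shows "v \<bullet> (P *v w) = w \<bullet> (P *v v)"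
  by (metis assms dot_lmul_matrix inner_commute transpose_matrix_vector)

lemma quadratic_form_congruence:
  fixes P :: "real^'m^'m" and M :: "real^'m^'n"
  shows "v \<bullet> ((M ** P ** transpose M) *v v) = (v v* M) \<bullet> (P *v (v v* M))"
  by (simp add: dot_lmul_matrix flip: matrix_vector_mul_assoc)

lemma psd_congruence: "psd P \<Longrightarrow> psd (transpose K ** P ** K)"
  using quadratic_form_congruence[of _ "transpose K" P]
  by (simp add: psd_def matrix_transpose_mul matrix_mul_assoc)

text \<open>The quadratic polynomial in \<open>t\<close> given by the form at
  \<open>v + t *\<^sub>R w\<close> is nonnegative, so its discriminant is at most zero.\<close>

lemma psd_Cauchy_Schwarz:
  assumes P: "psd P"
  shows "(v \<bullet> (P *v w))\<^sup>2 \<le> (v \<bullet> (P *v v)) * (w \<bullet> (P *v w))"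
proof -
  define a b c where "a = w \<bullet> (P *v w)" and "b = v \<bullet> (P *v w)" and "c = v \<bullet> (P *v v)"
  have comm: "w \<bullet> (P *v v) = b"
    using P by (simp add: b_def psd_def symmetric_form_commute)
  have q: "0 \<le> c + 2 * t * b + t\<^sup>2 * a" for t
  proof -
    have "0 \<le> (v + t *\<^sub>R w) \<bullet> (P *v (v + t *\<^sub>R w))"
      using P by (simp add: psd_def)
    also have "\<dots> = c + 2 * t * b + t\<^sup>2 * a"
      by (simp add: matrix_vector_right_distrib matrix_vector_mult_scaleR inner_add_left
          inner_add_right comm a_def c_def b_def[symmetric] power2_eq_square algebra_simps)
    finally show ?thesis .
  qed
  have a0: "0 \<le> a" and c0: "0 \<le> c" using P by (simp_all add: psd_def a_def c_def)
  have "b\<^sup>2 \<le> c * a"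
  proof (cases "a = 0")
    case True
    have "b = 0"
    proof (rule ccontr)
      assume "b \<noteq> 0"
      \<comment> \<open>With \<open>a = 0\<close> the polynomial is affine in \<open>t\<close>, and
        at this \<open>t\<close> its value is -1.\<close>
      then show False using q[of "- (c + 1) / (2 * b)"] True by (simp add: field_simps)
    qed
    then show ?thesis using True by simp
  next
    case False
    with a0 have "0 < a" by simp
    \<comment> \<open>This \<open>t\<close> minimizes the polynomial.\<close>
    then show ?thesis using q[of "- b / a"] by (simp add: field_simps power2_eq_square)
  qed
  then show ?thesis by (simp add: a_def b_def c_def)
qed

section \<open>Traces of products of semidefinite matrices\<close>

definition outer :: "real^'n \<Rightarrow> real^'n^'n" where
  "outer w = (\<chi> i j. w $ i * w $ j)"

lemma outer_mult_vector: "outer w *v v = (w \<bullet> v) *\<^sub>R w"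
  by (simp add: outer_def matrix_vector_mult_def vec_eq_iff inner_vec_def sum_distrib_left
      sum_distrib_right mult_ac)

lemma transpose_outer: "transpose (outer w) = outer w"
  by (simp add: outer_def transpose_def vec_eq_iff mult.commute)

lemma trace_mult_outer: "trace (S ** outer w) = w \<bullet> (S *v w)"
  by (simp add: trace_def outer_def matrix_matrix_mult_def matrix_vector_mult_def inner_vec_def
      sum_distrib_left mult_ac)

text \<open>Subtracting from \<open>P\<close> the rank-one matrix built from its \<open>i\<close>-th column (a Schur complement)
  keeps it positive semidefinite and clears that column, so \<open>P\<close> is a sum of matrices
  \<open>w w\<^sup>T\<close>.\<close>

lemma trace_psd_mult_nonneg:
  assumes S: "psd S" and "psd P"
  shows "0 \<le> trace (S ** P)"
  using \<open>psd P\<close>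
proof (induction "card {i. P *v axis i 1 \<noteq> 0}" arbitrary: P rule: less_induct)
  case less
  show ?case
  proof (cases "P = 0")
    case True
    then show ?thesis by (simp add: trace_def)
  next
    case False
    then obtain i where i: "P *v axis i 1 \<noteq> 0"
      by (metis (no_types, lifting) column_def matrix_vector_mult_basis vec_eq_iff vec_lambda_beta zero_index)
    define w where "w = P *v axis i 1"
    define p where "p = axis i 1 \<bullet> w"
    have sym: "transpose P = P" and pos: "0 \<le> v \<bullet> (P *v v)" for v
      using less.prems by (simp_all add: psd_def)
    \<comment> \<open>Divided by \<open>p\<close>, this is nonnegativity of the form of the Schur
      complement \<open>P'\<close> at \<open>v\<close>.\<close>
    have CS: "(v \<bullet> w)\<^sup>2 \<le> (v \<bullet> (P *v v)) * p" for v
      using psd_Cauchy_Schwarz[OF less.prems] by (simp add: w_def p_def)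
    \<comment> \<open>At \<open>v = w\<close>, a zero \<open>p\<close> would force
      \<open>w \<bullet> w = 0\<close>.\<close>
    have "p \<noteq> 0"
      using CS[of w] i by (auto simp: w_def)
    moreover have "0 \<le> p" using pos by (simp add: p_def w_def)
    ultimately have p: "0 < p" by simp
    define P' where "P' = P - (1 / p) *\<^sub>R outer w"
    have P'v: "P' *v v = P *v v - ((w \<bullet> v) / p) *\<^sub>R w" for v
      by (simp add: P'_def matrix_vector_mult_diff_rdistrib outer_mult_vector
          flip: scaleR_matrix_vector_assoc)
    have "psd P'"
      unfolding psd_def
    proof (intro conjI allI)
      show "transpose P' = P'"
        by (simp add: P'_def transpose_diff transpose_scalar transpose_outer sym)
      show "0 \<le> v \<bullet> (P' *v v)" for v
        using CS[of v] p
        by (simp add: P'v inner_diff_right field_simps power2_eq_square inner_commute)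
    qed
    moreover have "{j. P' *v axis j 1 \<noteq> 0} \<subset> {j. P *v axis j 1 \<noteq> 0}"
    proof
      \<comment> \<open>By symmetry, entry \<open>j\<close> of \<open>w\<close> lies in column
        \<open>j\<close> of \<open>P\<close>. Thus a column that vanishes in \<open>P\<close> also
        vanishes in \<open>P'\<close>, and the count of nonzero columns drops strictly because
        column \<open>i\<close> is cleared.\<close>
      have wj: "w \<bullet> axis j 1 = axis i 1 \<bullet> (P *v axis j 1)" for j
        by (metis inner_commute sym symmetric_form_commute w_def)
      show "{j. P' *v axis j 1 \<noteq> 0} \<subseteq> {j. P *v axis j 1 \<noteq> 0}"
        by (auto simp: P'v wj)
      have "P' *v axis i 1 = 0"
        using p by (simp add: P'v inner_commute p_def w_def[symmetric])
      then show "{j. P' *v axis j 1 \<noteq> 0} \<noteq> {j. P *v axis j 1 \<noteq> 0}"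
        using i by blast
    qed
    then have "card {j. P' *v axis j 1 \<noteq> 0} < card {j. P *v axis j 1 \<noteq> 0}"
      by (simp add: psubset_card_mono)
    ultimately have "0 \<le> trace (S ** P')"
      using less.hyps by blast
    moreover have "trace (S ** P) = trace (S ** P') + (w \<bullet> (S *v w)) / p"
      by (simp add: P'_def matrix_mul_diff_right matrix_mul_scaleR_right trace_sub trace_scaleR
          trace_mult_outer)
    moreover have "0 \<le> w \<bullet> (S *v w)" using S by (simp add: psd_def)
    ultimately show ?thesis using p by simp
  qed
qed

text \<open>By Cauchy-Schwarz, \<open>(v \<bullet> v) *\<^sub>R mat 1 - outer v\<close> is
  semidefinite; its product with \<open>P\<close> therefore has nonnegative trace.\<close>

lemma quadratic_form_le_trace:
  fixes P :: "real^'n^'n"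
  assumes "psd P"
  shows "v \<bullet> (P *v v) \<le> trace P * (v \<bullet> v)"
proof -
  have "psd ((v \<bullet> v) *\<^sub>R mat 1 - outer v)"
    unfolding psd_def
  proof (intro conjI allI)
    fix w :: "real^'n"
    have "(v \<bullet> w)\<^sup>2 \<le> (v \<bullet> v) * (w \<bullet> w)" by (rule Cauchy_Schwarz_ineq)
    then show "0 \<le> w \<bullet> (((v \<bullet> v) *\<^sub>R mat 1 - outer v) *v w)"
      by (simp add: matrix_vector_mult_diff_rdistrib outer_mult_vector inner_diff_right
          power2_eq_square inner_commute flip: scaleR_matrix_vector_assoc)
  qed (simp add: transpose_diff transpose_scalar transpose_outer)
  from trace_psd_mult_nonneg[OF assms this] show ?thesis
    by (simp add: matrix_mul_diff_right matrix_mul_scaleR_right trace_sub trace_scaleR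
        trace_mult_outer mult.commute)
qed

section \<open>Positive definite weights\<close>

lemma pos_def_imp_psd: "pos_def Q \<Longrightarrow> psd Q"
  unfolding pos_def_def psd_def
  by (metis inner_zero_left less_imp_le order_refl)

text \<open>The constant is the minimum of the form on the compact unit sphere; homogeneity of
  degree two extends the bound to all vectors.\<close>

lemma pos_def_coercive:
  fixes Q :: "real^'n^'n"
  assumes "pos_def Q"
  obtains q where "q > 0" "\<And>v. q * (v \<bullet> v) \<le> v \<bullet> (Q *v v)"
proof -
  let ?f = "\<lambda>v. v \<bullet> (Q *v v)"
  have cont: "continuous_on (sphere 0 1) ?f"
    by (intro continuous_intros linear_continuous_on linear_conv_bounded_linear[THEN iffD1]
        matrix_vector_mul_linear)
  have ne: "sphere (0::real^'n) 1 \<noteq> {}" by simp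
  obtain w where w: "w \<in> sphere 0 1" and min: "\<forall>v\<in>sphere 0 1. ?f w \<le> ?f v"
    using continuous_attains_inf[OF compact_sphere ne cont] by blast
  have "w \<noteq> 0" using w by auto
  then have "?f w > 0" using assms by (simp add: pos_def_def)
  moreover have "?f w * (v \<bullet> v) \<le> ?f v" for v
  proof (cases "v = 0")
    case False
    then have "v /\<^sub>R norm v \<in> sphere 0 1" by simp
    with min have "?f w \<le> ?f (v /\<^sub>R norm v)" by blast
    also have "\<dots> = ?f v / (v \<bullet> v)"
      by (simp add: matrix_vector_mult_scaleR dot_square_norm divide_simps power2_eq_square)
    finally show ?thesis using False by (simp add: field_simps)
  qed simp
  ultimately show ?thesis using that by blast
qed

text \<open>With \<open>q\<close> the coercivity constant, \<open>Q - q *\<^sub>R mat 1\<close> is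
  semidefinite and is paired with \<open>P\<close> under the trace. This is what lets a bound on the
  cost bound \<open>trace P\<close>.\<close>

lemma pos_def_trace_ge:
  fixes Q :: "real^'n^'n"
  assumes "pos_def Q"
  obtains q where "q > 0" "\<And>P. psd P \<Longrightarrow> q * trace P \<le> trace (Q ** P)"
proof -
  obtain q where q: "q > 0" "\<And>v. q * (v \<bullet> v) \<le> v \<bullet> (Q *v v)"
    using pos_def_coercive[OF assms] by blast
  have "psd (Q - q *\<^sub>R mat 1)"
    using q(2) assms
    by (simp add: psd_def pos_def_def transpose_diff transpose_scalar
        matrix_vector_mult_diff_rdistrib inner_diff_right flip: scaleR_matrix_vector_assoc)
  then have "q * trace P \<le> trace (Q ** P)" if "psd P" for P
    using trace_psd_mult_nonneg[OF _ that, of "Q - q *\<^sub>R mat 1"]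
    by (simp add: matrix_mul_diff_left trace_sub trace_scaleR trace_mul_sym[of _ P]
        matrix_mul_scaleR_right)
  with q(1) that show ?thesis by blast
qed

section \<open>Norms on a Euclidean space\<close>

text \<open>The triangle inequality for \<open>v\<close> and its negative gives
  \<open>0 \<le> 2 * \<nu> v\<close>.\<close>

lemma is_norm_nonneg:
  assumes "is_norm \<nu>"
  shows "0 \<le> \<nu> v"
proof -
  have "\<nu> (v + (-1) *\<^sub>R v) \<le> \<nu> v + \<nu> ((-1) *\<^sub>R v)" "\<nu> ((-1) *\<^sub>R v) = \<bar>-1\<bar> * \<nu> v" "\<nu> 0 = 0"
    using assms unfolding is_norm_def by blast+
  then show ?thesis by simp
qed

text \<open>One half of the equivalence of norms in finite dimension: expansion in the basis makes
  \<open>\<nu>\<close> Lipschitz, so it attains a minimum on the unit sphere, which is positive by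
  definiteness.\<close>

lemma is_norm_dominates_norm:
  fixes \<nu> :: "'v::euclidean_space \<Rightarrow> real"
  assumes "is_norm \<nu>"
  obtains k where "k > 0" "\<And>v. norm v \<le> k * \<nu> v"
proof -
  have zero: "\<nu> v = 0 \<longleftrightarrow> v = 0" and scale: "\<nu> (c *\<^sub>R v) = \<bar>c\<bar> * \<nu> v"
    and tri: "\<nu> (v + w) \<le> \<nu> v + \<nu> w" for v w c
    using assms unfolding is_norm_def by blast+
  define C where "C = (\<Sum>b\<in>Basis. \<nu> b)"
  have sum_le: "\<nu> (\<Sum>b\<in>B. f b) \<le> (\<Sum>b\<in>B. \<nu> (f b))" if "finite B" for f and B :: "'v set"
    using that
  proof (induction B)
    case empty
    show ?case using zero[of 0] by simp
  next
    case (insert b B)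
    then show ?case using tri[of "f b" "sum f B"] by simp
  qed
  have upper: "\<nu> v \<le> C * norm v" for v
  proof -
    have "\<nu> v \<le> (\<Sum>b\<in>Basis. \<nu> ((v \<bullet> b) *\<^sub>R b))"
      using sum_le[of Basis "\<lambda>b. (v \<bullet> b) *\<^sub>R b"] by (simp add: euclidean_representation)
    also have "\<dots> \<le> (\<Sum>b\<in>Basis. \<nu> b * norm v)"
    proof (rule sum_mono)
      fix b :: 'v
      assume "b \<in> Basis"
      then show "\<nu> ((v \<bullet> b) *\<^sub>R b) \<le> \<nu> b * norm v"
        using mult_left_mono[OF Basis_le_norm is_norm_nonneg[OF assms]]
        by (simp add: scale mult.commute[of "\<bar>_\<bar>"])
    qed
    finally show ?thesis by (simp add: C_def sum_distrib_right)
  qed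
  have "\<bar>\<nu> v - \<nu> w\<bar> \<le> C * norm (v - w)" for v w
    using tri[of "v - w" w] tri[of "w - v" v] upper[of "v - w"] upper[of "w - v"]
    by (simp add: norm_minus_commute abs_le_iff)
  moreover have "0 \<le> C" by (simp add: C_def is_norm_nonneg[OF assms] sum_nonneg)
  ultimately have "C-lipschitz_on UNIV \<nu>"
    by (intro lipschitz_onI) (simp_all add: dist_norm)
  then have cont: "continuous_on (sphere 0 1) \<nu>"
    using lipschitz_on_continuous_on continuous_on_subset by blast
  have ne: "sphere (0::'v) 1 \<noteq> {}" by simp
  obtain w where w: "w \<in> sphere 0 1" and min: "\<forall>v\<in>sphere 0 1. \<nu> w \<le> \<nu> v"
    using continuous_attains_inf[OF compact_sphere ne cont] by blast
  have "\<nu> w > 0"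
    using w zero[of w] is_norm_nonneg[OF assms, of w] by fastforce
  moreover have "norm v \<le> (1 / \<nu> w) * \<nu> v" for v
  proof (cases "v = 0")
    case False
    then have "v /\<^sub>R norm v \<in> sphere 0 1" by simp
    with min have "\<nu> w \<le> \<nu> (v /\<^sub>R norm v)" by blast
    with False \<open>\<nu> w > 0\<close> show ?thesis by (simp add: scale field_simps)
  qed (simp add: zero[THEN iffD2])
  ultimately show ?thesis using that[of "1 / \<nu> w"] by simp
qed

section \<open>The right inverse\<close>

text \<open>Full row rank makes \<open>transpose W\<close> injective. The form of the Gram matrix
  \<open>W ** transpose W\<close> at \<open>w\<close> is the squared length of
  \<open>transpose W *v w\<close>, so the Gram matrix has trivial kernel.\<close>

lemma right_inv:
  fixes W :: "real^'t^'r"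
  assumes "rank W = CARD('r)"
  shows "W ** right_inv W = mat 1"
proof -
  have inj: "inj ((*v) (transpose W))"
    using assms by (simp add: rank_transpose full_rank_injective[symmetric])
  have "w = 0" if "(W ** transpose W) *v w = 0" for w
  proof -
    have "(w v* W) \<bullet> (w v* W) = w \<bullet> ((W ** transpose W) *v w)"
      by (simp add: dot_lmul_matrix flip: matrix_vector_mul_assoc)
    then have "transpose W *v w = transpose W *v 0" using that by simp
    with inj show ?thesis by (metis injD)
  qed
  then have "invertible (W ** transpose W)"
    by (metis invertible_left_inverse matrix_left_invertible_ker)
  \<comment> \<open>\<open>matrix_inv\<close> is defined by choice; invertibility supplies the
    witness.\<close>
  then have "(W ** transpose W) ** matrix_inv (W ** transpose W) = mat 1"
    unfolding invertible_def matrix_inv_def by (rule someI2_ex) blast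
  then show ?thesis by (simp add: right_inv_def matrix_mul_assoc)
qed

lemma mult_null_proj:
  fixes W :: "real^'t^'r"
  assumes "rank W = CARD('r)"
  shows "W ** null_proj W = 0"
  by (simp add: null_proj_def matrix_mul_diff_right matrix_mul_assoc right_inv[OF assms])

lemma null_proj_idem:
  fixes W :: "real^'t^'r"
  assumes "rank W = CARD('r)"
  shows "null_proj W ** null_proj W = null_proj W"
proof -
  have "null_proj W ** null_proj W = null_proj W - right_inv W ** (W ** null_proj W)"
    by (simp add: null_proj_def[of W] matrix_mul_diff_left matrix_mul_assoc)
  then show ?thesis by (simp add: mult_null_proj[OF assms])
qed


section \<open>The penalty is exact\<close>

lemma loewner_ge_mat_1_imp_psd:
  assumes "mat 1 \<preceq>\<^sub>L P"
  shows "psd P"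
proof -
  have "transpose (P - mat 1) = P - mat 1" and *: "0 \<le> v \<bullet> ((P - mat 1) *v v)" for v
    using assms by (simp_all add: loewner_le_def psd_def)
  moreover have "0 \<le> v \<bullet> (P *v v)" for v
    using *[of v] inner_ge_zero[of v]
    by (simp add: matrix_vector_mult_diff_rdistrib inner_diff_right del: inner_ge_zero)
  ultimately show ?thesis by (simp add: psd_def transpose_diff)
qed

text \<open>A pointwise form of the constraint, in which a perturbation of \<open>G\<close> can be
  estimated vector by vector; symmetry of the left-hand matrix follows from that of
  \<open>P\<close>.\<close>

lemma lyapunov_condition:
  assumes "transpose P = P"
  shows "(X ** G ** P ** transpose G ** transpose X - P + mat 1) \<preceq>\<^sub>L 0 \<longleftrightarrow>
    (\<forall>v. (v v* (X ** G)) \<bullet> (P *v (v v* (X ** G))) \<le> v \<bullet> (P *v v) - v \<bullet> v)"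
proof -
  let ?M = "X ** G"
  have eq: "X ** G ** P ** transpose G ** transpose X = ?M ** P ** transpose ?M"
    by (simp add: matrix_transpose_mul matrix_mul_assoc)
  have "transpose (?M ** P ** transpose ?M) = ?M ** P ** transpose ?M"
    by (simp add: matrix_transpose_mul matrix_mul_assoc assms)
  then have "transpose (0 - (?M ** P ** transpose ?M - P + mat 1))
      = 0 - (?M ** P ** transpose ?M - P + mat 1)"
    by (simp add: transpose_diff assms)
  moreover have "v \<bullet> ((0 - (?M ** P ** transpose ?M - P + mat 1)) *v v)
      = v \<bullet> (P *v v) - v \<bullet> v - (v v* ?M) \<bullet> (P *v (v v* ?M))" for v
    by (simp only: matrix_vector_mult_diff_rdistrib matrix_vector_mult_add_rdistrib inner_diff_right
        inner_add_right quadratic_form_congruence) simp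
  ultimately show ?thesis
    unfolding loewner_le_def psd_def eq by simp
qed

lemma lqr_cost_ge:
  assumes "psd P" "psd R"
  shows "trace (Q ** P) \<le> lqr_cost Q R (P, K, G)"
  using trace_psd_mult_nonneg[OF psd_congruence[OF assms(2)] assms(1)]
  by (simp add: lqr_cost_def trace_add)

text \<open>A separate \<open>G'\<close> allows the rescaling of \<open>P\<close> to be combined
  with the projection of \<open>G\<close>.\<close>

lemma lqr_cost_scaleR: "lqr_cost Q R (c *\<^sub>R P, K, G') = c * lqr_cost Q R (P, K, G)"
  by (simp add: lqr_cost_def trace_add trace_scaleR matrix_mul_scaleR_right distrib_left)

lemma reg_feasible_psd: "(P, K, G) \<in> reg_feasible X1 W0 \<Longrightarrow> psd P"
  by (simp add: reg_feasible_def loewner_ge_mat_1_imp_psd)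

text \<open>With \<open>s\<close> and \<open>e\<close> the images of \<open>v\<close> under the transposes of \<open>X1 G\<close> and \<open>X1 N\<close>, the removal
  of the nullspace component \<open>N\<close> of \<open>G\<close> replaces the quadratic form \<open>s \<bullet> P s\<close> in the Lyapunov
  inequality by \<open>(s - e) \<bullet> P (s - e)\<close>, hence violates it by at most \<open>\<delta> = c (2 b + b\<^sup>2)\<close> times the
  identity. Dividing \<open>P\<close> by \<open>1 - \<delta>\<close> restores it.\<close>

lemma direct_feasible_project:
  fixes X1 :: "real^'t^'n" and W0 :: "real^'t^('m::finite + 'n)"
  assumes rank: "rank W0 = CARD('m + 'n)"
    and feas: "(P, K, G) \<in> reg_feasible X1 W0"
    and c: "trace P \<le> c" "0 \<le> c"
    and b: "\<And>v. norm (v v* (X1 ** (null_proj W0 ** G))) \<le> b * norm v" "0 \<le> b"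
    and less: "c * (2 * b + b\<^sup>2) < 1"
  shows "((1 / (1 - c * (2 * b + b\<^sup>2))) *\<^sub>R P, K, G - null_proj W0 ** G)
    \<in> direct_feasible X1 W0"
proof -
  define N where "N = null_proj W0 ** G"
  define \<delta> where "\<delta> = c * (2 * b + b\<^sup>2)"
  define r where "r = 1 / (1 - \<delta>)"
  have \<delta>: "0 \<le> \<delta>" "\<delta> < 1" using c b less by (simp_all add: \<delta>_def)
  then have r: "1 \<le> r" "r * (1 - \<delta>) = 1" by (simp_all add: r_def)
  have P: "psd P" using feas by (rule reg_feasible_psd)
  have sym: "transpose P = P" and ge: "mat 1 \<preceq>\<^sub>L P" and K: "vstack K (mat 1) = W0 ** G"
    using feas by (simp_all add: reg_feasible_def)
  have lyap: "(v v* (X1 ** G)) \<bullet> (P *v (v v* (X1 ** G))) \<le> v \<bullet> (P *v v) - v \<bullet> v" for v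
    using feas lyapunov_condition[OF sym, of X1 G] by (simp add: reg_feasible_def)
  have P_le: "v \<bullet> (P *v v) \<le> c * (v \<bullet> v)" for v
    using quadratic_form_le_trace[OF P, of v] mult_right_mono[OF c(1) inner_ge_zero, of v] by linarith
  have perturbed: "(v v* (X1 ** (G - N))) \<bullet> (P *v (v v* (X1 ** (G - N))))
      \<le> v \<bullet> (P *v v) - v \<bullet> v + \<delta> * (v \<bullet> v)" for v
  proof -
    define s e where "s = v v* (X1 ** G)" and "e = v v* (X1 ** N)"
    have se: "v v* (X1 ** (G - N)) = s - e"
      by (simp add: s_def e_def matrix_mul_diff_right vector_matrix_mult_diff_rdistrib)
    have "norm e \<le> b * norm v" using b by (simp add: e_def N_def)
    then have "(norm e)\<^sup>2 \<le> (b * norm v)\<^sup>2" by (intro power_mono) auto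
    then have ee: "e \<bullet> e \<le> b\<^sup>2 * (v \<bullet> v)" by (simp add: power_mult_distrib dot_square_norm)
    have "e \<bullet> (P *v e) \<le> c * (e \<bullet> e)" by (rule P_le)
    also have "\<dots> \<le> c * (b\<^sup>2 * (v \<bullet> v))" using ee c(2) by (rule mult_left_mono)
    finally have ePe: "e \<bullet> (P *v e) \<le> c * (b\<^sup>2 * (v \<bullet> v))" .
    have sPs: "s \<bullet> (P *v s) \<le> v \<bullet> (P *v v) - v \<bullet> v" using lyap by (simp add: s_def)
    \<comment> \<open>The Lyapunov inequality itself bounds \<open>s\<close> in the
      \<open>P\<close>-form, so the estimate does not involve the size of \<open>G\<close>.\<close>
    have sPs': "s \<bullet> (P *v s) \<le> c * (v \<bullet> v)" using sPs P_le[of v] inner_ge_zero[of v] by linarith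
    have "(s \<bullet> (P *v e))\<^sup>2 \<le> (s \<bullet> (P *v s)) * (e \<bullet> (P *v e))"
      by (rule psd_Cauchy_Schwarz[OF P])
    also have "\<dots> \<le> (c * (v \<bullet> v)) * (c * (b\<^sup>2 * (v \<bullet> v)))"
      using sPs' ePe P c(2) by (intro mult_mono) (auto simp: psd_def)
    also have "\<dots> = (c * b * (v \<bullet> v))\<^sup>2" by (simp add: power2_eq_square mult_ac)
    finally have "\<bar>s \<bullet> (P *v e)\<bar> \<le> c * b * (v \<bullet> v)"
      using c(2) b(2) by (simp flip: abs_le_square_iff)
    moreover have "(s - e) \<bullet> (P *v (s - e))
        = s \<bullet> (P *v s) - 2 * (s \<bullet> (P *v e)) + e \<bullet> (P *v e)"
      by (simp add: matrix_vector_mult_diff_distrib inner_diff_left inner_diff_right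
          symmetric_form_commute[OF sym, of e s])
    moreover have "\<delta> * (v \<bullet> v) = 2 * (c * b * (v \<bullet> v)) + c * (b\<^sup>2 * (v \<bullet> v))"
      by (simp add: \<delta>_def algebra_simps)
    ultimately show ?thesis unfolding se using sPs ePe by linarith
  qed
  have "(v v* (X1 ** (G - N))) \<bullet> ((r *\<^sub>R P) *v (v v* (X1 ** (G - N))))
      \<le> v \<bullet> ((r *\<^sub>R P) *v v) - v \<bullet> v" for v
  proof -
    let ?w = "v v* (X1 ** (G - N))"
    have "r * (?w \<bullet> (P *v ?w)) \<le> r * (v \<bullet> (P *v v) - v \<bullet> v + \<delta> * (v \<bullet> v))"
      using perturbed[of v] r(1) by (intro mult_left_mono) auto
    \<comment> \<open>Since \<open>r * (1 - \<delta>) = 1\<close>, the scaled inequality again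
      carries the identity with coefficient exactly one.\<close>
    also have "\<dots> = r * (v \<bullet> (P *v v)) - (r * (1 - \<delta>)) * (v \<bullet> v)" by (simp add: algebra_simps)
    finally show ?thesis by (simp add: r(2) flip: scaleR_matrix_vector_assoc)
  qed
  moreover have sym': "transpose (r *\<^sub>R P) = r *\<^sub>R P" by (simp add: transpose_scalar sym)
  moreover have "mat 1 \<preceq>\<^sub>L r *\<^sub>R P"
  proof -
    have "v \<bullet> v \<le> r * (v \<bullet> (P *v v))" for v
    proof -
      have "0 \<le> v \<bullet> ((P - mat 1) *v v)" using ge by (simp add: loewner_le_def psd_def)
      then have "v \<bullet> v \<le> v \<bullet> (P *v v)"
        by (simp add: matrix_vector_mult_diff_rdistrib inner_diff_right)
      also have "\<dots> \<le> r * (v \<bullet> (P *v v))"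
        using mult_right_mono[OF r(1), of "v \<bullet> (P *v v)"] P by (simp add: psd_def)
      finally show ?thesis .
    qed
    then show ?thesis
      by (simp add: loewner_le_def psd_def transpose_diff sym' matrix_vector_mult_diff_rdistrib
          inner_diff_right flip: scaleR_matrix_vector_assoc)
  qed
  moreover have "W0 ** (G - N) = W0 ** G"
    by (simp add: N_def matrix_mul_diff_right matrix_mul_assoc mult_null_proj[OF rank])
  moreover have "null_proj W0 ** (G - N) = 0"
    by (simp add: N_def matrix_mul_diff_right matrix_mul_assoc null_proj_idem[OF rank])
  ultimately have "(r *\<^sub>R P, K, G - N) \<in> direct_feasible X1 W0"
    using lyapunov_condition[OF sym', of X1 "G - N"] K
    by (simp add: direct_feasible_def reg_feasible_def)
  then show ?thesis by (simp add: r_def \<delta>_def N_def)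
qed

section \<open>A lower bound for the penalized cost\<close>

lemma vector_matrix_mult_norm_bound:
  fixes X :: "real^'t^'n"
  obtains k where "k > 0"
    "\<And>(N :: real^'p^'t) v. norm (v v* (X ** N)) \<le> k * norm N * norm v"
proof -
  have "bilinear (\<lambda>(N :: real^'p^'t) v. v v* (X ** N))"
    unfolding bilinear_def
    by (auto intro!: linearI simp: matrix_add_ldistrib matrix_mul_scaleR_right
        vector_matrix_mult_add_rdistrib vector_matrix_left_distrib scaleR_vector_matrix_assoc
        vector_scaleR_matrix_ac)
  then have "bounded_bilinear (\<lambda>(N :: real^'p^'t) v. v v* (X ** N))"
    by (simp add: bilinear_conv_bounded_bilinear)
  from bounded_bilinear.pos_bounded[OF this] show ?thesis
    using that by (metis mult.commute mult.left_commute)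
qed

text \<open>Only points with cost at most \<open>J\<close> need an argument. On them
  \<open>trace P\<close> is bounded uniformly, so a single \<open>L\<close> serves all of
  them.\<close>

lemma exact_penalty_bound:
  fixes X1 :: "real^'t^'n" and W0 :: "real^'t^('m::finite + 'n)"
  assumes rank: "rank W0 = CARD('m + 'n)"
    and Q: "pos_def Q" and R: "pos_def R" and norm: "is_norm \<nu>"
    and lower: "\<And>z. z \<in> direct_feasible X1 W0 \<Longrightarrow> J \<le> lqr_cost Q R z"
    and J: "0 \<le> J"
  obtains L where "0 \<le> L"
    "\<And>P K G. (P, K, G) \<in> reg_feasible X1 W0 \<Longrightarrow>
      J \<le> lqr_cost Q R (P, K, G) + L * \<nu> (null_proj W0 ** G)"
proof -
  obtain q where q: "q > 0" "\<And>P. psd P \<Longrightarrow> q * trace P \<le> trace (Q ** P)"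
    using pos_def_trace_ge[OF Q] by blast
  obtain k1 where k1: "k1 > 0" "\<And>N. norm N \<le> k1 * \<nu> N"
    using is_norm_dominates_norm[OF norm] by blast
  obtain k2 where k2: "k2 > 0"
    "\<And>(N :: real^'n^'t) v. norm (v v* (X1 ** N)) \<le> k2 * norm N * norm v"
    using vector_matrix_mult_norm_bound by blast
  define k where "k = k2 * k1"
  \<comment> \<open>Bounds \<open>trace P\<close>, as \<open>q * trace P\<close> is at most the cost
    and hence at most \<open>J\<close>.\<close>
  define c where "c = J / q"
  \<comment> \<open>For \<open>\<epsilon> \<le> 1\<close>,
    \<open>\<epsilon>\<^sup>2 \<le> \<epsilon>\<close> makes \<open>J * \<delta>\<close> at most
    \<open>L * \<epsilon>\<close>. The summand 1 ensures \<open>J \<le> L\<close>, which settles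
    \<open>\<epsilon> > 1\<close>.\<close>
  define L where "L = J * (1 + c * (2 * k + k\<^sup>2))"
  have k: "k > 0" and c: "0 \<le> c" using k1 k2 q J by (simp_all add: k_def c_def)
  have "J \<le> lqr_cost Q R (P, K, G) + L * \<nu> (null_proj W0 ** G)"
    if feas: "(P, K, G) \<in> reg_feasible X1 W0" for P K G
  proof (cases "lqr_cost Q R (P, K, G) \<le> J")
    case True
    define N where "N = null_proj W0 ** G"
    define \<epsilon> where "\<epsilon> = \<nu> N"
    define \<delta> where "\<delta> = c * (2 * (k * \<epsilon>) + (k * \<epsilon>)\<^sup>2)"
    have \<epsilon>: "0 \<le> \<epsilon>" by (simp add: \<epsilon>_def is_norm_nonneg[OF norm])
    have P: "psd P" using feas by (rule reg_feasible_psd)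
    have "q * trace P \<le> lqr_cost Q R (P, K, G)"
      using q(2)[OF P] lqr_cost_ge[OF P pos_def_imp_psd[OF R], of Q K G] by simp
    moreover have "0 \<le> trace P"
      using trace_psd_mult_nonneg[OF _ P, of "mat 1"] by (simp add: psd_def)
    ultimately have cost: "0 \<le> lqr_cost Q R (P, K, G)" and trP: "trace P \<le> c"
      using True q(1) mult_nonneg_nonneg[of q "trace P"]
      by (linarith, simp add: c_def pos_le_divide_eq mult.commute[of _ q])
    have e: "norm (v v* (X1 ** N)) \<le> (k * \<epsilon>) * norm v" for v
    proof -
      have "norm (v v* (X1 ** N)) \<le> k2 * norm N * norm v" by (rule k2(2))
      also have "\<dots> \<le> k2 * (k1 * \<epsilon>) * norm v"
        using k1(2)[of N] k2(1) by (intro mult_right_mono mult_left_mono) (auto simp: \<epsilon>_def)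
      finally show ?thesis by (simp add: k_def mult_ac)
    qed
    \<comment> \<open>For \<open>\<delta> < 1\<close> the projected and rescaled point is feasible
      for the direct problem; for \<open>\<delta> \<ge> 1\<close> the term
      \<open>J * \<delta>\<close> alone exceeds or equals \<open>J\<close>.\<close>
    have bound: "J \<le> lqr_cost Q R (P, K, G) + J * \<delta>"
    proof (cases "\<delta> < 1")
      case True
      have "((1 / (1 - \<delta>)) *\<^sub>R P, K, G - N) \<in> direct_feasible X1 W0"
        using direct_feasible_project[OF rank feas trP c, of "k * \<epsilon>"] e k \<epsilon> True
        by (simp add: \<delta>_def N_def)
      then have "J \<le> 1 / (1 - \<delta>) * lqr_cost Q R (P, K, G)"
        using lower lqr_cost_scaleR by metis
      then show ?thesis using True by (simp add: field_simps)
    next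
      case False
      then have "J * 1 \<le> J * \<delta>" using J by (intro mult_left_mono) auto
      then show ?thesis using cost by simp
    qed
    have "J \<le> lqr_cost Q R (P, K, G) + L * \<epsilon>"
    proof (cases "\<epsilon> \<le> 1")
      case True
      then have "\<epsilon>\<^sup>2 \<le> \<epsilon>" using \<epsilon> by (simp add: power2_eq_square mult_left_le)
      then have "c * (2 * (k * \<epsilon>) + k\<^sup>2 * \<epsilon>\<^sup>2) \<le> c * (2 * (k * \<epsilon>) + k\<^sup>2 * \<epsilon>)"
        using c by (intro mult_left_mono add_left_mono) auto
      then have "\<delta> \<le> (1 + c * (2 * k + k\<^sup>2)) * \<epsilon>"
        using \<epsilon> by (simp add: \<delta>_def power_mult_distrib algebra_simps)
      then have "J * \<delta> \<le> J * ((1 + c * (2 * k + k\<^sup>2)) * \<epsilon>)" using J by (rule mult_left_mono)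
      then show ?thesis using bound by (simp add: L_def mult.assoc)
    next
      case False
      have "J * 1 \<le> J * (1 + c * (2 * k + k\<^sup>2))"
        using J c k by (intro mult_left_mono) auto
      then have "J \<le> L" by (simp add: L_def)
      also have "L * 1 \<le> L * \<epsilon>" using False \<open>J \<le> L\<close> J by (intro mult_left_mono) auto
      finally show ?thesis using cost by simp
    qed
    then show ?thesis by (simp add: \<epsilon>_def N_def)
  next
    case False
    have "0 \<le> L" using J c k by (simp add: L_def)
    then show ?thesis using False is_norm_nonneg[OF norm] by (simp add: add_increasing2)
  qed
  moreover have "0 \<le> L" using J c k by (simp add: L_def)
  ultimately show ?thesis using that by blast
qed

section \<open>Optimal values and minimizers\<close>

lemma opt_val_eq_Inf:
  assumes "S \<noteq> {}" "\<And>z. z \<in> S \<Longrightarrow> b \<le> f z"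
  shows "opt_val f S = ereal (Inf (f ` S))"
  using assms ereal_Inf'[of "f ` S"] bdd_belowI2[of S b f]
  by (simp add: opt_val_def image_image)

lemma direct_feasible_subset: "direct_feasible X1 W0 \<subseteq> reg_feasible X1 W0"
  by (auto simp: direct_feasible_def)

lemma reg_cost_direct:
  assumes "is_norm \<nu>" "z \<in> direct_feasible X1 W0"
  shows "reg_cost Q R W0 \<nu> lam z = lqr_cost Q R z"
  using assms by (auto simp: reg_cost_def direct_feasible_def is_norm_def)

text \<open>The regularized problem is a relaxation: every direct point stays feasible and has zero
  penalty.\<close>

lemma opt_val_reg_le_direct:
  assumes "is_norm \<nu>"
  shows "opt_val (reg_cost Q R W0 \<nu> lam) (reg_feasible X1 W0)
    \<le> opt_val (lqr_cost Q R) (direct_feasible X1 W0)"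
  unfolding opt_val_def
proof (rule INF_mono)
  fix z
  assume "z \<in> direct_feasible X1 W0"
  then show "\<exists>w\<in>reg_feasible X1 W0. ereal (reg_cost Q R W0 \<nu> lam w) \<le> ereal (lqr_cost Q R z)"
    using direct_feasible_subset[of X1 W0] reg_cost_direct[OF assms, of z X1 W0 Q R lam]
    by (intro bexI[of _ z]) auto
qed

text \<open>The threshold is \<open>L + 1\<close>. A weight of at least \<open>L\<close> already
  makes the values agree; the strict excess over \<open>L\<close> forces the penalty of every
  regularized minimizer to vanish.\<close>

lemma exact_penalty:
  fixes X1 :: "real^'t^'n" and W0 :: "real^'t^('m::finite + 'n)"
  assumes rank: "rank W0 = CARD('m + 'n)"
    and Q: "pos_def Q" and R: "pos_def R" and norm: "is_norm \<nu>"
    and ne: "direct_feasible X1 W0 \<noteq> {}"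
  obtains lam0 where "0 \<le> lam0"
    "\<And>lam. lam0 \<le> lam \<Longrightarrow>
      opt_val (reg_cost Q R W0 \<nu> lam) (reg_feasible X1 W0)
        = opt_val (lqr_cost Q R) (direct_feasible X1 W0)"
    "\<And>lam. lam0 \<le> lam \<Longrightarrow>
      minimizers (reg_cost Q R W0 \<nu> lam) (reg_feasible X1 W0)
        = minimizers (lqr_cost Q R) (direct_feasible X1 W0)"
proof -
  let ?D = "direct_feasible X1 W0" and ?F = "reg_feasible X1 W0" and ?c = "lqr_cost Q R"
  define J where "J = Inf (?c ` ?D)"
  have cost: "0 \<le> ?c z" if "z \<in> ?F" for z
  proof -
    obtain P K G where z: "z = (P, K, G)" by (cases z)
    then have P: "psd P" using that reg_feasible_psd by blast
    show ?thesis
      using trace_psd_mult_nonneg[OF pos_def_imp_psd[OF Q] P]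
        lqr_cost_ge[OF P pos_def_imp_psd[OF R], of Q K G] z by simp
  qed
  have cost_D: "0 \<le> ?c z" if "z \<in> ?D" for z using that cost direct_feasible_subset by blast
  have J_lower: "J \<le> ?c z" if "z \<in> ?D" for z
    unfolding J_def using that cost_D by (intro cINF_lower bdd_belowI2) auto
  have J_greatest: "a \<le> J" if "\<And>z. z \<in> ?D \<Longrightarrow> a \<le> ?c z" for a
    unfolding J_def using that ne by (intro cINF_greatest) auto
  have J0: "0 \<le> J" using cost_D by (rule J_greatest)
  obtain L where L: "0 \<le> L" "\<And>P K G. (P, K, G) \<in> ?F \<Longrightarrow>
      J \<le> ?c (P, K, G) + L * \<nu> (null_proj W0 ** G)"
    using exact_penalty_bound[OF rank Q R norm J_lower J0] by blast
  have J_le: "J + (lam - L) * \<nu> (null_proj W0 ** G) \<le> reg_cost Q R W0 \<nu> lam (P, K, G)"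
    if "(P, K, G) \<in> ?F" for P K G lam
    using L(2)[OF that] by (simp add: reg_cost_def algebra_simps)
  have J_le': "J \<le> reg_cost Q R W0 \<nu> lam z" if "z \<in> ?F" "L \<le> lam" for z lam
  proof -
    obtain P K G where z: "z = (P, K, G)" by (cases z)
    have "0 \<le> (lam - L) * \<nu> (null_proj W0 ** G)"
      using that is_norm_nonneg[OF norm] by simp
    then show ?thesis using J_le[of P K G lam] that z by simp
  qed
  have "opt_val (reg_cost Q R W0 \<nu> lam) ?F = opt_val ?c ?D" if "L + 1 \<le> lam" for lam
  proof (rule antisym)
    show "opt_val ?c ?D \<le> opt_val (reg_cost Q R W0 \<nu> lam) ?F"
      using J_le'[of _ lam] that
      by (subst opt_val_eq_Inf[OF ne cost_D]) (auto simp: opt_val_def J_def intro!: INF_greatest)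
  qed (rule opt_val_reg_le_direct[OF norm])
  moreover have "minimizers (reg_cost Q R W0 \<nu> lam) ?F = minimizers ?c ?D"
    if lam: "L + 1 \<le> lam" for lam
  proof (intro subset_antisym subsetI)
    fix z
    assume z: "z \<in> minimizers (reg_cost Q R W0 \<nu> lam) ?F"
    obtain P K G where PKG: "z = (P, K, G)" by (cases z)
    have zF: "z \<in> ?F" using z by (simp add: minimizers_def)
    have min: "reg_cost Q R W0 \<nu> lam z \<le> ?c w" if "w \<in> ?D" for w
    proof -
      have "w \<in> ?F" using that direct_feasible_subset by blast
      then have "reg_cost Q R W0 \<nu> lam z \<le> reg_cost Q R W0 \<nu> lam w"
        using z by (simp add: minimizers_def)
      then show ?thesis by (simp add: reg_cost_direct[OF norm that])
    qed
    then have "reg_cost Q R W0 \<nu> lam z \<le> J" by (rule J_greatest)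
    \<comment> \<open>The minimizer costs at most \<open>J\<close>, while \<open>J_le\<close> puts
      its cost at \<open>J\<close> plus this excess or more.\<close>
    then have "(lam - L) * \<nu> (null_proj W0 ** G) \<le> 0"
      using J_le[of P K G lam] zF PKG by simp
    then have "\<nu> (null_proj W0 ** G) \<le> 0" using lam by (simp add: mult_le_0_iff)
    then have "null_proj W0 ** G = 0"
      using is_norm_nonneg[OF norm, of "null_proj W0 ** G"] norm by (simp add: is_norm_def)
    then have zD: "z \<in> ?D" using zF PKG by (simp add: direct_feasible_def)
    then show "z \<in> minimizers ?c ?D"
      using min reg_cost_direct[OF norm zD, of Q R lam] by (simp add: minimizers_def)
  next
    fix z
    assume z: "z \<in> minimizers ?c ?D"
    then have zD: "z \<in> ?D" and "?c z \<le> J"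
      by (auto simp: minimizers_def intro: J_greatest)
    \<comment> \<open>A direct minimizer attains \<open>J\<close>, which bounds all regularized
      costs from below.\<close>
    then have "reg_cost Q R W0 \<nu> lam z \<le> reg_cost Q R W0 \<nu> lam w" if "w \<in> ?F" for w
      using J_le'[OF that, of lam] lam reg_cost_direct[OF norm zD, of Q R lam] by simp
    then show "z \<in> minimizers (reg_cost Q R W0 \<nu> lam) ?F"
      using subsetD[OF direct_feasible_subset zD] by (simp add: minimizers_def)
  qed
  ultimately show ?thesis using that[of "L + 1"] L(1) by simp
qed

theorem mainTheorem3:
  fixes A :: "real^'n^'n" and B :: "real^'m^'n"
    and u :: "nat \<Rightarrow> real^'m" and x d :: "nat \<Rightarrow> real^'n"
    and \<tau> :: "'t::finite \<Rightarrow> nat"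
    and U0 :: "real^'t^'m" and X0 X1 :: "real^'t^'n" and W0 :: "real^'t^('m + 'n)"
    and Q :: "real^'n^'n" and R :: "real^'m^'m"
    and \<nu> :: "real^'n^'t \<Rightarrow> real"
  assumes stab: "stabilizable A B"
    and columns: "bij_betw \<tau> UNIV {..<CARD('t)}"
    and dynamics: "\<forall>k<CARD('t). x (Suc k) = A *v x k + B *v u k + d k"
    and U0: "U0 = data_matrix \<tau> u"
    and X0: "X0 = data_matrix \<tau> x"
    and X1: "X1 = data_matrix \<tau> (\<lambda>k. x (Suc k))"
    and W0: "W0 = vstack U0 X0"
    and rank_W0: "rank W0 = CARD('n) + CARD('m)"
    and Q: "pos_def Q" and R: "pos_def R"
    and norm: "is_norm \<nu>"
  shows "((reg_feasible X1 W0 \<noteq> {} \<longrightarrow> direct_feasible X1 W0 \<noteq> {}) \<longrightarrow>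
           (\<exists>lam0\<ge>0. \<forall>lam\<ge>lam0.
              opt_val (reg_cost Q R W0 \<nu> lam) (reg_feasible X1 W0)
                = opt_val (lqr_cost Q R) (direct_feasible X1 W0) \<and>
              minimizers (reg_cost Q R W0 \<nu> lam) (reg_feasible X1 W0)
                = minimizers (lqr_cost Q R) (direct_feasible X1 W0))) \<and>
         (\<forall>lam\<ge>0.
            opt_val (reg_cost Q R W0 \<nu> lam) (reg_feasible X1 W0)
              \<le> opt_val (lqr_cost Q R) (direct_feasible X1 W0))"
proof -
  have rank: "rank W0 = CARD('m + 'n)" using rank_W0 by simp
  show ?thesis
  proof (intro conjI impI allI)
    assume imp: "reg_feasible X1 W0 \<noteq> {} \<longrightarrow> direct_feasible X1 W0 \<noteq> {}"
    show "\<exists>lam0\<ge>0. \<forall>lam\<ge>lam0.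
        opt_val (reg_cost Q R W0 \<nu> lam) (reg_feasible X1 W0)
          = opt_val (lqr_cost Q R) (direct_feasible X1 W0) \<and>
        minimizers (reg_cost Q R W0 \<nu> lam) (reg_feasible X1 W0)
          = minimizers (lqr_cost Q R) (direct_feasible X1 W0)"
    proof (cases "direct_feasible X1 W0 = {}")
      \<comment> \<open>Both feasible sets are then empty, so both values are
        \<open>\<infinity>\<close>, there are no minimizers, and any threshold works.\<close>
      case True
      with imp have "reg_feasible X1 W0 = {}" by blast
      with True show ?thesis by (auto simp: opt_val_def minimizers_def)
    next
      case False
      then show ?thesis using exact_penalty[OF rank Q R norm False] by metis
    qed
  qed (rule opt_val_reg_le_direct[OF norm])
qed
end
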